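(* Let $G$ be a finite, simple, loopless, regular, connected graph with $\operatorname{diam}(G)\geq 3$. Then \[ e(G^3) \geq \left(1+\frac{1}{6}\right) e(G). \]
   Context: For vertices $u,v$ of $G$, $\operatorname{dist}(u,v)$ is the length of a shortest path between them. The cube $G^3$ of $G$ is the graph on $V(G)$ in which two distinct vertices $x,y$ are adjacent if and only if $\operatorname{dist}(x,y)\leq 3$ in $G$. The diameter $\operatorname{diam}(G)$ is the maximum distance between two vertices of $G$. $e(H)$ denotes the number of edges of a graph $H$. *)

theory Defs
  imports "Graph_Theory.Graph_Theory" "HOL-Library.Extended_Nat"
begin

text \<open>
  A finite simple graph is a \<^locale>\<open>pair_graph\<close>: finitely many vertices, and a symmetric
  irreflexive set of arcs. Every undirected edge is thus represented by two opposite arcs,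
  so edges are counted as two-element vertex sets.
\<close>

definition edges :: "'a pair_pre_digraph \<Rightarrow> 'a set set" where
  "edges G = (\<lambda>(u, v). {u, v}) ` parcs G"

definition num_edges :: "'a pair_pre_digraph \<Rightarrow> nat" where
  "num_edges G = card (edges G)"

text \<open>By symmetry of the arcs, the out-degree of a vertex is its number of neighbours.\<close>

definition regular_graph :: "'a pair_pre_digraph \<Rightarrow> bool" where
  "regular_graph G \<longleftrightarrow> (\<exists>d. \<forall>v \<in> pverts G. out_degree (with_proj G) v = d)"

text \<open>
  The infimum is attained if there is a path, and is \<open>\<infinity>\<close> otherwise. The predicate
  \<open>apath u p v\<close> says that the arc list \<open>p\<close> is a path from \<open>u\<close> to \<open>v\<close> without repeated vertices.
\<close>

definition graph_dist :: "'a pair_pre_digraph \<Rightarrow> 'a \<Rightarrow> 'a \<Rightarrow> enat" where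
  "graph_dist G u v = (INF p \<in> {p. pre_digraph.apath (with_proj G) u p v}. enat (length p))"

definition diam :: "'a pair_pre_digraph \<Rightarrow> enat" where
  "diam G = (SUP u \<in> pverts G. SUP v \<in> pverts G. graph_dist G u v)"

definition cube :: "'a pair_pre_digraph \<Rightarrow> 'a pair_pre_digraph" where
  "cube G = \<lparr> pverts = pverts G,
     parcs = {(x, y). x \<in> pverts G \<and> y \<in> pverts G \<and> x \<noteq> y \<and> graph_dist G x y \<le> 3} \<rparr>"

end

theory Submission
  imports Defs
begin

text \<open>
  Let \<open>d\<close> be the degree of \<open>G\<close>, and call a vertex good if its degree \<open>d\<^sub>3\<close> in \<open>G\<^sup>3\<close> is at least
  \<open>2 d\<close>. Every vertex \<open>v\<close> satisfies \<open>d\<^sub>3(v) + g(v) \<ge> 2 d\<close>, where \<open>g(v)\<close> is the number of its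
  good neighbours. This is clear if all vertices are within distance 2 of \<open>v\<close>, since
  \<open>diam G \<ge> 3\<close> gives two disjoint closed neighbourhoods, hence \<open>2 d + 2\<close> vertices. Otherwise there is
  an edge \<open>y w\<close> from a vertex \<open>y\<close> at distance 2 to a vertex \<open>w\<close> that is further away. The disjoint
  closed neighbourhoods of \<open>v\<close> and \<open>w\<close> lie in the ball of radius 3 around any common neighbour
  of \<open>v\<close> and \<open>y\<close>, so these common neighbours are good; all other neighbours of \<open>y\<close> add to
  \<open>d\<^sub>3(v)\<close>. Summing over \<open>v\<close>, where each good vertex is counted \<open>d\<close> times in \<open>\<Sum> g(v)\<close> and has
  an excess of at least \<open>d\<close> in \<open>\<Sum> d\<^sub>3(v)\<close>, gives even \<open>e(G\<^sup>3) \<ge> 3/2 e(G)\<close>.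
\<close>

section \<open>Neighbourhood counting in finite relations\<close>

lemma card_rel_eq_sum_card_Image:
  assumes "finite V" "R \<subseteq> V \<times> V"
  shows "card R = (\<Sum>v\<in>V. card (R `` {v}))"
proof -
  have "R = (SIGMA v:V. R `` {v})"
    using assms by auto
  moreover have "\<forall>v\<in>V. finite (R `` {v})"
    using assms by (auto intro: finite_subset[of _ V])
  ultimately show ?thesis
    using assms(1) by (metis card_SigmaI)
qed

text \<open>Graph-free core: \<open>E\<close> and \<open>F\<close> stand for the arcs of the graph
  and of its cube. Distances enter only through walks of length at most 3, and the pair
  \<open>(a, b)\<close> encodes diameter at least 3.\<close>

lemma card_cube_relation_ge:
  fixes E F :: "'a rel"
  assumes fin: "finite V" and E: "E \<subseteq> V \<times> V" and F: "F \<subseteq> V \<times> V"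
    and sym: "sym E" and irr: "irrefl E"
    and deg: "\<And>v. v \<in> V \<Longrightarrow> card (E `` {v}) = d"
    and conn: "\<And>A. A \<subseteq> V \<Longrightarrow> A \<noteq> {} \<Longrightarrow> E `` A \<subseteq> A \<Longrightarrow> A = V"
    and cube: "\<And>u v. u \<in> V \<Longrightarrow> u \<noteq> v \<Longrightarrow> (u, v) \<in> E \<union> E O E \<union> E O E O E \<Longrightarrow> (u, v) \<in> F"
    and far: "a \<in> V" "b \<in> V" "(a, b) \<notin> Id \<union> E \<union> E O E"
  shows "3 * card E \<le> 2 * card F"
proof -
  define good where "good = {v \<in> V. 2 * d \<le> card (F `` {v})}"
  have symD: "(y, x) \<in> E" if "(x, y) \<in> E" for x y
    using sym that by (rule symD)
  have irrD: "(x, x) \<notin> E" for x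
    using irr by (simp add: irrefl_def)
  have finE: "finite (E `` A)" for A
    using fin E by (auto intro: finite_subset[of _ V])
  have finF: "finite (F `` A)" for A
    using fin F by (auto intro: finite_subset[of _ V])
  have disjoint_balls: "2 * d + 2 \<le> card A"
    if "u \<in> V" "w \<in> V" "(u, w) \<notin> Id \<union> E \<union> E O E" "finite A"
      "insert u (E `` {u}) \<union> insert w (E `` {w}) \<subseteq> A" for u w A
  proof -
    \<comment> \<open>A common element would give a walk of length at most 2 from \<open>u\<close>
      to \<open>w\<close>.\<close>
    have "insert u (E `` {u}) \<inter> insert w (E `` {w}) = {}"
      using that(3) symD by blast
    then have "card (insert u (E `` {u}) \<union> insert w (E `` {w})) = Suc d + Suc d"
      using finE irrD deg[OF that(1)] deg[OF that(2)]
      by (subst card_Un_disjoint) auto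
    then show ?thesis
      using card_mono[OF that(4,5)] by simp
  qed
  have cardV: "2 * d + 2 \<le> card V"
    using far E by (intro disjoint_balls[OF far fin]) auto
  have E_le_F: "d \<le> card (F `` {v})" if "v \<in> V" for v
  proof -
    have "(v, x) \<in> F" if "(v, x) \<in> E" for x
      using cube[OF \<open>v \<in> V\<close>, of x] that irrD[of v] by auto
    then have "E `` {v} \<subseteq> F `` {v}"
      by auto
    then show ?thesis
      using card_mono[OF finF] deg[OF that] by metis
  qed
  have key: "2 * d \<le> card (F `` {v}) + card (E `` {v} \<inter> good)" if v: "v \<in> V" for v
  proof (cases "insert v (E `` {v} \<union> (E O E) `` {v}) = V")
    case True
    then have "(v, z) \<in> F" if "z \<in> V" "z \<noteq> v" for z
      using cube[OF v, of z] that by auto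
    then have "V - {v} \<subseteq> F `` {v}"
      by auto
    then have "card V - 1 \<le> card (F `` {v})"
      using card_mono[OF finF] v fin by (metis card_Diff_singleton)
    then show ?thesis
      using cardV by simp
  next
    case False
    define B where "B = insert v (E `` {v} \<union> (E O E) `` {v})"
    have "B \<subseteq> V" "B \<noteq> {}" "B \<noteq> V"
      using v E False unfolding B_def by auto
    then obtain y w where yw: "y \<in> B" "(y, w) \<in> E" "w \<notin> B"
      using conn[of B] by blast
    have y: "y \<in> V" and w: "w \<in> V"
      using yw E by auto
    have nvy: "(y, v) \<notin> E"
      using yw symD unfolding B_def by blast
    have far_vw: "(v, w) \<notin> Id \<union> E \<union> E O E"
      using yw(3) unfolding B_def by auto
    have "E `` {v} \<inter> E `` {y} \<subseteq> good"
    proof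
      fix x
      assume x: "x \<in> E `` {v} \<inter> E `` {y}"
      then have xV: "x \<in> V" and xv: "(x, v) \<in> E" and xy: "(x, y) \<in> E"
        using E symD by auto
      have "2 * d + 2 \<le> card (insert x (F `` {x}))"
      proof (rule disjoint_balls[OF v w far_vw])
        have "(x, z) \<in> F" if "z \<in> insert v (E `` {v}) \<union> insert w (E `` {w})" "x \<noteq> z" for z
        proof (rule cube[OF xV \<open>x \<noteq> z\<close>])
          \<comment> \<open>Go through \<open>v\<close> to reach its neighbours in 2 steps, and
            through \<open>y\<close> and \<open>w\<close> to reach those of \<open>w\<close> in
            3.\<close>
          show "(x, z) \<in> E \<union> E O E \<union> E O E O E"
            using that(1) xv xy yw(2) by blast
        qed
        then show "insert v (E `` {v}) \<union> insert w (E `` {w}) \<subseteq> insert x (F `` {x})"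
          by auto
      qed (simp add: finF)
      also have "\<dots> \<le> Suc (card (F `` {x}))"
        by (rule card_insert_le_m1) simp_all
      finally show "x \<in> good"
        using xV by (simp add: good_def)
    qed
    then have good: "card (E `` {v} \<inter> E `` {y}) \<le> card (E `` {v} \<inter> good)"
      using finE by (intro card_mono) auto
    have "(v, z) \<in> F" if "z \<in> E `` {v} \<union> E `` {y}" for z
    proof (rule cube[OF v])
      show "v \<noteq> z"
        using that nvy irrD by auto
      show "(v, z) \<in> E \<union> E O E \<union> E O E O E"
        using that yw unfolding B_def by blast
    qed
    then have "E `` {v} \<union> E `` {y} \<subseteq> F `` {v}"
      by auto
    then have "card (E `` {v} \<union> E `` {y}) \<le> card (F `` {v})"
      using card_mono[OF finF] by metis
    \<comment> \<open>What the union loses to common neighbours is made up by good neighbours of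
      \<open>v\<close>.\<close>
    moreover have "card (E `` {v} \<union> E `` {y}) + card (E `` {v} \<inter> E `` {y}) = 2 * d"
      using card_Un_Int[OF finE finE, of "{v}" "{y}"] deg[OF v] deg[OF y] by simp
    ultimately show ?thesis
      using good by linarith
  qed
  have good_fin: "finite good" and good_V: "good \<subseteq> V"
    using fin by (auto simp: good_def)
  have "(E \<inter> UNIV \<times> good) `` {v} = E `` {v} \<inter> good" for v
    by auto
  moreover have "card (E \<inter> UNIV \<times> good) = (\<Sum>v\<in>V. card ((E \<inter> UNIV \<times> good) `` {v}))"
    using E by (intro card_rel_eq_sum_card_Image[OF fin]) auto
  ultimately have "(\<Sum>v\<in>V. card (E `` {v} \<inter> good)) = card (E \<inter> UNIV \<times> good)"
    by simp
  \<comment> \<open>By symmetry, reversal matches arcs into \<open>good\<close> with arcs out of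
    it.\<close>
  also have "\<dots> = card (E \<inter> good \<times> UNIV)"
    by (rule bij_betw_same_card[of prod.swap], rule bij_betwI[where g = prod.swap]) (use symD in auto)
  also have "\<dots> = (\<Sum>v\<in>V. card ((E \<inter> good \<times> UNIV) `` {v}))"
    using E by (intro card_rel_eq_sum_card_Image[OF fin]) auto
  also have "\<dots> = (\<Sum>v\<in>V. if v \<in> good then d else 0)"
  proof (rule sum.cong)
    fix v
    assume "v \<in> V"
    moreover have "(E \<inter> good \<times> UNIV) `` {v} = (if v \<in> good then E `` {v} else {})"
      by auto
    ultimately show "card ((E \<inter> good \<times> UNIV) `` {v}) = (if v \<in> good then d else 0)"
      using deg by simp
  qed simp
  finally have sum_good: "(\<Sum>v\<in>V. card (E `` {v} \<inter> good)) = (\<Sum>v\<in>V. if v \<in> good then d else 0)" .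
  have "3 * card E = (\<Sum>v\<in>V. 3 * d)"
    using card_rel_eq_sum_card_Image[OF fin E] deg by (simp add: sum_distrib_left)
  \<comment> \<open>The first summand is at least \<open>2 * d\<close> by \<open>key\<close>, the
    second at least \<open>d\<close> in both cases. The truncated subtraction is exact by
    \<open>E_le_F\<close>, so after summation \<open>sum_good\<close> cancels the two
    corrections.\<close>
  also have "\<dots> \<le> (\<Sum>v\<in>V. (card (F `` {v}) + card (E `` {v} \<inter> good))
      + (card (F `` {v}) - (if v \<in> good then d else 0)))"
  proof (rule sum_mono)
    fix v
    assume "v \<in> V"
    then show "3 * d \<le> (card (F `` {v}) + card (E `` {v} \<inter> good))
        + (card (F `` {v}) - (if v \<in> good then d else 0))"
      using key[of v] E_le_F[of v] by (auto simp: good_def)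
  qed
  also have "\<dots> = 2 * (\<Sum>v\<in>V. card (F `` {v}))"
    unfolding sum.distrib sum_good using E_le_F
    by (subst sum_subtractf_nat) (auto simp: sum_mono)
  also have "(\<Sum>v\<in>V. card (F `` {v})) = card F"
    using card_rel_eq_sum_card_Image[OF fin F] by simp
  finally show ?thesis .
qed

section \<open>Arcs versus undirected edges\<close>

text \<open>An edge comes from at most its two orientations. Applied to the cube, this avoids
  proving \<open>graph_dist\<close> symmetric.\<close>

lemma card_le_twice_num_edges:
  fixes G :: "'a pair_pre_digraph"
  assumes "finite (parcs G)"
  shows "card (parcs G) \<le> 2 * num_edges G"
proof -
  define f where "f = (\<lambda>(u :: 'a, v). {u, v})"
  have "parcs G \<subseteq> (\<Union>e\<in>edges G. f -` {e})"
    by (auto simp: edges_def f_def)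
  moreover have fibre: "finite (f -` {e}) \<and> card (f -` {e}) \<le> 2" if "e \<in> edges G" for e
  proof -
    obtain u v where e: "e = {u, v}"
      using \<open>e \<in> edges G\<close> by (auto simp: edges_def)
    have "f -` {e} \<subseteq> {(u, v), (v, u)}"
    proof
      fix p
      assume "p \<in> f -` {e}"
      then have "{fst p, snd p} = {u, v}"
        by (simp add: f_def e case_prod_beta)
      then show "p \<in> {(u, v), (v, u)}"
        unfolding doubleton_eq_iff by (metis insertCI prod.collapse)
    qed
    then show ?thesis
      using finite_subset[of "f -` {e}" "{(u, v), (v, u)}"] card_mono[of "{(u, v), (v, u)}" "f -` {e}"]
        card_length[of "[(u, v), (v, u)]"] by simp
  qed
  moreover have fin: "finite (edges G)"
    using assms by (simp add: edges_def)
  ultimately have "card (parcs G) \<le> card (\<Union>e\<in>edges G. f -` {e})"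
    by (intro card_mono) auto
  also have "\<dots> \<le> (\<Sum>e\<in>edges G. card (f -` {e}))"
    using fin by (rule card_UN_le)
  also have "\<dots> \<le> (\<Sum>e\<in>edges G. 2)"
    using fibre by (intro sum_mono) auto
  finally show ?thesis
    by (simp add: num_edges_def)
qed

text \<open>Both orientations of an edge are arcs, distinct since there are no loops, and different
  edges have disjoint fibres.\<close>

lemma twice_num_edges_le_card:
  fixes G :: "'a pair_pre_digraph"
  assumes "finite (parcs G)" "sym (parcs G)" "irrefl (parcs G)"
  shows "2 * num_edges G \<le> card (parcs G)"
proof -
  define f where "f = (\<lambda>(u :: 'a, v). {u, v})"
  have fin: "finite (edges G)"
    using assms by (simp add: edges_def)
  have "2 \<le> card (parcs G \<inter> f -` {e})" if "e \<in> edges G" for e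
  proof -
    obtain u v where uv: "e = {u, v}" "(u, v) \<in> parcs G"
      using \<open>e \<in> edges G\<close> by (auto simp: edges_def)
    then have "(v, u) \<in> parcs G" "u \<noteq> v"
      using assms(2,3) by (auto dest: symD simp: irrefl_def)
    then have "{(u, v), (v, u)} \<subseteq> parcs G \<inter> f -` {e}" "card {(u, v), (v, u)} = 2"
      using uv by (auto simp: f_def)
    then show ?thesis
      using card_mono assms(1) by (metis finite_Int)
  qed
  then have "2 * num_edges G \<le> (\<Sum>e\<in>edges G. card (parcs G \<inter> f -` {e}))"
    unfolding num_edges_def
    using sum_bounded_below[of "edges G" 2 "\<lambda>e. card (parcs G \<inter> f -` {e})"] by (simp add: mult.commute)
  also have "\<dots> = card (\<Union>e\<in>edges G. parcs G \<inter> f -` {e})"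
    using fin assms(1) by (intro card_UN_disjoint[symmetric]) auto
  also have "\<dots> \<le> card (parcs G)"
    using assms(1) by (intro card_mono) auto
  finally show ?thesis .
qed

section \<open>Walks and distance\<close>

text \<open>Cutting cycles out of a walk only shortens it. This lets walks with repeated vertices
  bound \<open>graph_dist\<close>, an infimum over paths.\<close>

lemma (in wf_digraph) apath_no_longer_than_awalk:
  assumes "awalk u p v"
  obtains q where "apath u q v" "length q \<le> length p"
proof -
  have "apath u (awalk_to_apath p) v"
    using assms by (rule apath_awalk_to_apath)
  moreover have "length (awalk_to_apath p) \<le> length p"
    using assms
  proof (induct rule: awalk_to_apath_induct)
    case (path p)
    then show ?case
      by (subst awalk_to_apath.simps) (auto simp: apath_def)
  next
    case (decomp p q r s)
    then show ?case
      using step_awalk_to_apath[of _ p _ q r s] by (auto elim!: awalk_cyc_decompE)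
  qed
  ultimately show thesis
    using that by blast
qed

lemma (in pair_wf_digraph) graph_dist_le_length:
  assumes "awalk u p v"
  shows "graph_dist G u v \<le> enat (length p)"
proof -
  obtain q where "apath u q v" "length q \<le> length p"
    using assms by (rule apath_no_longer_than_awalk)
  then show ?thesis
    unfolding graph_dist_def by (intro INF_lower2[of q]) auto
qed

section \<open>Transfer to graphs\<close>

theorem theorem4:
  fixes G :: "'a pair_pre_digraph"
  assumes "pair_graph G"
    and "connected (with_proj G)"
    and "regular_graph G"
    and "diam G \<ge> 3"
  shows "real (num_edges (cube G)) \<ge> (1 + 1 / 6) * real (num_edges G)"
proof -
  interpret pair_graph G
    by fact
  define E F where "E = parcs G" and "F = parcs (cube G)"
  have E: "E \<subseteq> pverts G \<times> pverts G"
    using wellformed' by (auto simp: E_def)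
  have F: "F \<subseteq> pverts G \<times> pverts G"
    by (auto simp: F_def cube_def)
  have sym: "sym E"
    using pair_sym_arcs by (simp add: E_def symmetric_def)
  have irr: "irrefl E"
    using pair_no_loops by (force simp: E_def irrefl_def)
  obtain d where "\<And>v. v \<in> pverts G \<Longrightarrow> out_degree (with_proj G) v = d"
    using assms(3) by (auto simp: regular_graph_def)
  moreover have "out_degree (with_proj G) v = card (E `` {v})" for v
    unfolding out_degree_def out_arcs_def E_def
    by (rule bij_betw_same_card[of snd], rule bij_betwI[where g = "\<lambda>w. (v, w)"]) auto
  ultimately have deg: "card (E `` {v}) = d" if "v \<in> pverts G" for v
    using that by simp
  \<comment> \<open>Symmetric arcs make the graph strongly connected, and reachability cannot leave
    a set closed under \<open>E\<close>.\<close>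
  have conn: "A = pverts G" if "A \<subseteq> pverts G" "A \<noteq> {}" "E `` A \<subseteq> A" for A
  proof -
    have "v \<in> A" if v: "v \<in> pverts G" for v
    proof -
      obtain u where u: "u \<in> A" "u \<in> pverts G"
        using \<open>A \<noteq> {}\<close> \<open>A \<subseteq> pverts G\<close> by auto
      have "strongly_connected (with_proj G)"
        using assms(2) pair_sym_arcs by (rule symmetric_connected_imp_strongly_connected[rotated])
      then have "u \<rightarrow>\<^sup>*\<^bsub>with_proj G\<^esub> v"
        using u v by (auto simp: strongly_connected_def)
      then show ?thesis
        using u(1) \<open>E `` A \<subseteq> A\<close> by (induct rule: reachable_induct) (auto simp: E_def)
    qed
    with that(1) show ?thesis
      by blast
  qed
  have walk0: "graph_dist G u v \<le> enat 0" if "u = v" "u \<in> pverts G" for u v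
    using graph_dist_le_length[of u "[]" v] that by (simp add: awalk_Nil_iff)
  have walk1: "graph_dist G u v \<le> enat 1" if "(u, v) \<in> E" for u v
    using graph_dist_le_length[of u "[(u, v)]" v] that
    by (auto simp: awalk_simps E_def wellformed')
  have walk2: "graph_dist G u v \<le> enat 2" if "(u, v) \<in> E O E" for u v
  proof -
    obtain x where "(u, x) \<in> E" "(x, v) \<in> E"
      using \<open>(u, v) \<in> E O E\<close> by auto
    then show ?thesis
      using graph_dist_le_length[of u "[(u, x), (x, v)]" v]
      by (auto simp: awalk_simps E_def wellformed' numeral_2_eq_2)
  qed
  have walk3: "graph_dist G u v \<le> enat 3" if "(u, v) \<in> E O E O E" for u v
  proof -
    obtain x y where "(u, x) \<in> E" "(x, y) \<in> E" "(y, v) \<in> E"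
      using \<open>(u, v) \<in> E O E O E\<close> by auto
    then show ?thesis
      using graph_dist_le_length[of u "[(u, x), (x, y), (y, v)]" v]
      by (auto simp: awalk_simps E_def wellformed' numeral_3_eq_3)
  qed
  have cube: "(u, v) \<in> F" if uv: "u \<in> pverts G" "u \<noteq> v" "(u, v) \<in> E \<union> E O E \<union> E O E O E" for u v
  proof -
    consider "(u, v) \<in> E" | "(u, v) \<in> E O E" | "(u, v) \<in> E O E O E"
      using uv(3) by blast
    then have "graph_dist G u v \<le> enat 3"
      by cases (rule order_trans[OF walk1] order_trans[OF walk2] walk3; simp; fail)+
    moreover have "v \<in> pverts G"
      using uv(3) E by auto
    ultimately show ?thesis
      using uv(1,2) by (simp add: F_def cube_def numeral_eq_enat)
  qed
  \<comment> \<open>A supremum above 2 forces a single pair at distance above 2.\<close>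
  obtain a b where ab: "a \<in> pverts G" "b \<in> pverts G" "enat 2 < graph_dist G a b"
  proof -
    have "enat 2 < diam G"
      using assms(4) by (auto simp: numeral_eq_enat elim!: order.strict_trans2[rotated])
    then show thesis
      using that by (auto simp: diam_def less_SUP_iff)
  qed
  moreover have "(a, b) \<notin> Id \<union> E \<union> E O E"
    using ab walk0[of a b] walk1[of a b] walk2[of a b] by (cases "graph_dist G a b") auto
  ultimately have "3 * card E \<le> 2 * card F"
    using card_cube_relation_ge[OF pair_finite_verts E F sym irr deg conn cube] by blast
  moreover have "finite F"
    using F pair_finite_verts by (auto intro: finite_subset[of _ "pverts G \<times> pverts G"])
  then have "card F \<le> 2 * num_edges (cube G)"
    unfolding F_def by (rule card_le_twice_num_edges)
  moreover have "2 * num_edges G \<le> card E"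
    using sym irr pair_finite_arcs unfolding E_def by (intro twice_num_edges_le_card)
  \<comment> \<open>Each edge stands for two arcs on both sides, so the ratio 3/2 carries over; it
    exceeds 7/6.\<close>
  ultimately have "3 * num_edges G \<le> 2 * num_edges (cube G)"
    by linarith
  then have "real (3 * num_edges G) \<le> real (2 * num_edges (cube G))"
    by (rule of_nat_mono)
  then show ?thesis
    by (simp add: field_simps)
qed

end
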